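(* As $h \to \infty$, $|\Omega(h)| = O\left(\frac{(4+\sqrt{8})^{h+1}}{\sqrt{(h+1)^{3}}}\right)$.
   Context: For a positive integer $h$, let $\Omega(h)$ (the set of states of the paper's dynamic program for the rectilinear TSP) be the set of pairs $(x,\pi)$ where $x=(x_1,\dots,x_h)\in\{0,U,E\}^h$ and $\pi$ is a non-crossing partition of $Z=\{i : x_i \neq 0\}$ (no $a<b<c<d$ in $Z$ with $a,c$ in one block and $b,d$ in a different block), such that every block of $\pi$ contains an even number (possibly zero) of indices $i$ with $x_i=U$, and every singleton block $\{i\}$ has $x_i=E$. *)

theory Defs
  imports Complex_Main "HOL-Library.Disjoint_Sets" "HOL-Library.FuncSet"
    "HOL-Library.Landau_Symbols"
begin

datatype label = Lab0 | LabU | LabE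

definition noncrossing :: "nat set set \<Rightarrow> bool" where
  "noncrossing P \<longleftrightarrow>
     \<not> (\<exists>B\<in>P. \<exists>C\<in>P. B \<noteq> C \<and>
          (\<exists>a b c d. a < b \<and> b < c \<and> c < d \<and> a \<in> B \<and> c \<in> B \<and> b \<in> C \<and> d \<in> C))"

definition support :: "nat \<Rightarrow> (nat \<Rightarrow> label) \<Rightarrow> nat set" where
  "support h x = {i \<in> {1..h}. x i \<noteq> Lab0}"

(* Vectors in {0,U,E}^h are extensional functions on {1..h}: their values outside {1..h} are
   fixed, so each vector has exactly one representative and the cardinality is the intended one. *)
definition Omega :: "nat \<Rightarrow> ((nat \<Rightarrow> label) \<times> nat set set) set" where
  "Omega h = {(x, P).
     x \<in> {1..h} \<rightarrow>\<^sub>E UNIV \<and>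
     partition_on (support h x) P \<and>
     noncrossing P \<and>
     (\<forall>B\<in>P. even (card {i \<in> B. x i = LabU})) \<and>
     (\<forall>i. {i} \<in> P \<longrightarrow> x i = LabE)}"

(* card is 0 on infinite sets, so card (Omega h) is meaningful only by this fact. *)
lemma finite_Omega: "finite (Omega h)"
proof (rule finite_subset)
  show "Omega h \<subseteq> ({1..h} \<rightarrow>\<^sub>E UNIV) \<times> Pow (Pow {1..h})"
    by (auto simp: Omega_def support_def partition_on_def)
  have "(UNIV :: label set) = {Lab0, LabU, LabE}"
    using label.exhaust by auto
  then have "finite (UNIV :: label set)"
    by (metis finite.emptyI finite.insertI)
  then show "finite (({1..h} \<rightarrow>\<^sub>E (UNIV :: label set)) \<times> Pow (Pow {1..h}))"
    by (intro finite_cartesian_product finite_PiE) auto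
qed

end

theory Submission
  imports Defs "HOL-Analysis.Analysis"
begin

text \<open>
  Reading the positions from left to right, call one an opener, a middle element or a closer
  according to whether its block has elements to the right, on both sides, or only to the left.
  Because the partition is noncrossing, the left neighbour of an element in its block is determined
  by the numbers of open blocks, so the partition is recovered from this word; the label of a closer
  is recovered from the parity condition. So \<open>Omega h\<close> injects into the Motzkin paths of length \<open>h\<close>
  with 4 colours of level steps (zero, singleton, middle with label U or E), 2 of up steps and 1 of
  down steps.

  After rescaling height \<open>j\<close> by \<open>2 powr (- j / 2)\<close> the step operator on heights is symmetric and has
  the eigenfunctions \<open>sin ((j + 1) t)\<close> with eigenvalues \<open>4 + sqrt 8 * cos t\<close>. Hence there are
  \<open>2 / pi * integral {0..pi} (\<lambda>t. (4 + sqrt 8 * cos t) ^ h * (sin t)\<^sup>2)\<close> such paths. The mass of the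
  integral sits at \<open>t\<close> of order \<open>h powr (- 1 / 2)\<close>, where the factor \<open>(sin t)\<^sup>2\<close> turns the usual
  \<open>h powr (- 1 / 2)\<close> into \<open>h powr (- 3 / 2)\<close>.
\<close>

section \<open>Openers, closers and open blocks\<close>

definition has_prev :: "nat set set \<Rightarrow> nat \<Rightarrow> bool" where
  "has_prev P i \<longleftrightarrow> (\<exists>B\<in>P. i \<in> B \<and> (\<exists>b\<in>B. b < i))"

definition has_next :: "nat set set \<Rightarrow> nat \<Rightarrow> bool" where
  "has_next P i \<longleftrightarrow> (\<exists>B\<in>P. i \<in> B \<and> (\<exists>b\<in>B. i < b))"

text \<open>These are the blocks straddling the gap between \<open>t\<close> and
  \<open>t + 1\<close>; their number is the height of the Motzkin path after \<open>t\<close>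
  steps.\<close>

definition open_blocks :: "nat set set \<Rightarrow> nat \<Rightarrow> nat set set" where
  "open_blocks P t = {B \<in> P. (\<exists>b\<in>B. b \<le> t) \<and> (\<exists>b\<in>B. t < b)}"

definition same_block :: "nat set set \<Rightarrow> nat \<Rightarrow> nat \<Rightarrow> bool" where
  "same_block P a b \<longleftrightarrow> (\<exists>B\<in>P. a \<in> B \<and> b \<in> B)"

lemma finite_open_blocks: "finite P \<Longrightarrow> finite (open_blocks P t)"
  by (simp add: open_blocks_def)

lemma disjoint_block_eq:
  assumes "disjoint P" "B \<in> P" "C \<in> P" "i \<in> B" "i \<in> C"
  shows "B = C"
  using assms by (auto simp: disjoint_def)

lemma has_prev_iff:
  assumes "disjoint P" "B \<in> P" "i \<in> B"
  shows "has_prev P i \<longleftrightarrow> (\<exists>b\<in>B. b < i)"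
  using assms disjoint_block_eq[OF assms(1,2)] unfolding has_prev_def by metis

lemma has_next_iff:
  assumes "disjoint P" "B \<in> P" "i \<in> B"
  shows "has_next P i \<longleftrightarrow> (\<exists>b\<in>B. i < b)"
  using assms disjoint_block_eq[OF assms(1,2)] unfolding has_next_def by metis

text \<open>Openness on either side of position \<open>Suc t\<close> is reduced to the same three
  facts about \<open>B\<close>: an element before \<open>Suc t\<close>, the element
  \<open>Suc t\<close>, an element after it. The transition lemmas then become
  propositional.\<close>

lemma in_open_blocks_iff:
  "B \<in> open_blocks P t \<longleftrightarrow>
    B \<in> P \<and> (\<exists>b\<in>B. b < Suc t) \<and> ((\<exists>b\<in>B. Suc t < b) \<or> Suc t \<in> B)"
  "B \<in> open_blocks P (Suc t) \<longleftrightarrow>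
    B \<in> P \<and> ((\<exists>b\<in>B. b < Suc t) \<or> Suc t \<in> B) \<and> (\<exists>b\<in>B. Suc t < b)"
proof -
  have "(\<exists>b\<in>B. b \<le> t) \<longleftrightarrow> (\<exists>b\<in>B. b < Suc t)"
    by (simp add: less_Suc_eq_le)
  moreover have "(\<exists>b\<in>B. t < b) \<longleftrightarrow> (\<exists>b\<in>B. Suc t < b) \<or> Suc t \<in> B"
    by (metis Suc_lessD Suc_lessI lessI)
  moreover have "(\<exists>b\<in>B. b \<le> Suc t) \<longleftrightarrow> (\<exists>b\<in>B. b < Suc t) \<or> Suc t \<in> B"
    by (metis le_less)
  ultimately show "B \<in> open_blocks P t \<longleftrightarrow>
      B \<in> P \<and> (\<exists>b\<in>B. b < Suc t) \<and> ((\<exists>b\<in>B. Suc t < b) \<or> Suc t \<in> B)"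
    "B \<in> open_blocks P (Suc t) \<longleftrightarrow>
      B \<in> P \<and> ((\<exists>b\<in>B. b < Suc t) \<or> Suc t \<in> B) \<and> (\<exists>b\<in>B. Suc t < b)"
    unfolding open_blocks_def by simp_all
qed

lemma open_blocks_eq:
  assumes "disjoint P" "has_prev P (Suc t) = has_next P (Suc t)"
  shows "open_blocks P (Suc t) = open_blocks P t"
proof (rule set_eqI)
  fix B
  show "B \<in> open_blocks P (Suc t) \<longleftrightarrow> B \<in> open_blocks P t"
    unfolding in_open_blocks_iff[of _ P t]
    using has_prev_iff[OF assms(1), of B "Suc t"] has_next_iff[OF assms(1), of B "Suc t"] assms(2)
    by argo
qed

lemma open_blocks_opener:
  assumes "disjoint P" "B \<in> P" "Suc t \<in> B" "\<not> has_prev P (Suc t)" "has_next P (Suc t)"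
  shows "open_blocks P (Suc t) = insert B (open_blocks P t)" "B \<notin> open_blocks P t"
proof -
  note B = has_prev_iff[OF assms(1-3)] has_next_iff[OF assms(1-3)]
  have "C \<in> open_blocks P (Suc t) \<longleftrightarrow> C = B \<or> C \<in> open_blocks P t" for C
  proof (cases "C = B")
    case True
    then show ?thesis
      unfolding in_open_blocks_iff[of _ P t] using B assms(2-5) by argo
  next
    case False
    then have "\<not> (C \<in> P \<and> Suc t \<in> C)"
      using disjoint_block_eq[OF assms(1)] assms(2,3) by metis
    then show ?thesis
      unfolding in_open_blocks_iff[of _ P t] using False by argo
  qed
  then show "open_blocks P (Suc t) = insert B (open_blocks P t)" by blast
  show "B \<notin> open_blocks P t"
    unfolding in_open_blocks_iff[of _ P t] using B assms(4) by argo
qed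

lemma open_blocks_closer:
  assumes "disjoint P" "B \<in> P" "Suc t \<in> B" "has_prev P (Suc t)" "\<not> has_next P (Suc t)"
  shows "open_blocks P t = insert B (open_blocks P (Suc t))" "B \<notin> open_blocks P (Suc t)"
proof -
  note B = has_prev_iff[OF assms(1-3)] has_next_iff[OF assms(1-3)]
  have "C \<in> open_blocks P t \<longleftrightarrow> C = B \<or> C \<in> open_blocks P (Suc t)" for C
  proof (cases "C = B")
    case True
    then show ?thesis
      unfolding in_open_blocks_iff[of _ P t] using B assms(2-5) by argo
  next
    case False
    then have "\<not> (C \<in> P \<and> Suc t \<in> C)"
      using disjoint_block_eq[OF assms(1)] assms(2,3) by metis
    then show ?thesis
      unfolding in_open_blocks_iff[of _ P t] using False by argo
  qed
  then show "open_blocks P t = insert B (open_blocks P (Suc t))" by blast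
  show "B \<notin> open_blocks P (Suc t)"
    unfolding in_open_blocks_iff[of _ P t] using B assms(5) by argo
qed

text \<open>Only the block containing \<open>Suc t\<close> can change its status, so the height
  moves by at most one. The second claim makes the truncated subtraction exact and excludes closers
  at height 0.\<close>

lemma card_open_blocks_Suc:
  assumes "disjoint P" "finite P"
  shows "card (open_blocks P (Suc t)) =
    (if has_prev P (Suc t) = has_next P (Suc t) then card (open_blocks P t)
     else if has_next P (Suc t) then Suc (card (open_blocks P t))
     else card (open_blocks P t) - 1)"
    and "has_prev P (Suc t) \<Longrightarrow> \<not> has_next P (Suc t) \<Longrightarrow> 0 < card (open_blocks P t)"
proof -
  note fin = finite_open_blocks[OF assms(2)]
  show "card (open_blocks P (Suc t)) =
    (if has_prev P (Suc t) = has_next P (Suc t) then card (open_blocks P t)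
     else if has_next P (Suc t) then Suc (card (open_blocks P t))
     else card (open_blocks P t) - 1)"
  proof (cases "has_prev P (Suc t) = has_next P (Suc t)")
    case True
    then show ?thesis using open_blocks_eq[OF assms(1)] by simp
  next
    case False
    then obtain B where B: "B \<in> P" "Suc t \<in> B"
      unfolding has_prev_def has_next_def by blast
    show ?thesis
    proof (cases "has_next P (Suc t)")
      case True
      then show ?thesis
        using False open_blocks_opener[OF assms(1) B] fin by simp
    next
      case next_False: False
      then show ?thesis
        using False open_blocks_closer[OF assms(1) B] fin by simp
    qed
  qed
  assume *: "has_prev P (Suc t)" "\<not> has_next P (Suc t)"
  then obtain B where B: "B \<in> P" "Suc t \<in> B"
    unfolding has_prev_def by blast
  then show "0 < card (open_blocks P t)"
    using open_blocks_closer[OF assms(1) B *] fin by simp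
qed

lemma open_blocks_zero:
  assumes "\<Union>P \<subseteq> {1..h}"
  shows "open_blocks P 0 = {}" "open_blocks P h = {}"
  using assms unfolding open_blocks_def by fastforce+

text \<open>The recurrence computes every height from the types of the positions, starting at height
  0.\<close>

lemma card_open_blocks_cong:
  assumes "disjoint P" "finite P" "disjoint Q" "finite Q"
    and "\<Union>P \<subseteq> {1..h}" "\<Union>Q \<subseteq> {1..h}"
    and "has_prev P = has_prev Q" "has_next P = has_next Q"
  shows "card (open_blocks P t) = card (open_blocks Q t)"
proof (induction t)
  case 0
  then show ?case using assms open_blocks_zero by simp
next
  case (Suc t)
  then show ?case using assms by (simp add: card_open_blocks_Suc)
qed

section \<open>Left neighbours and reconstruction of a noncrossing partition\<close>

lemma noncrossingD:
  assumes "noncrossing P" "B \<in> P" "C \<in> P" "a \<in> B" "b \<in> C" "c \<in> B" "d \<in> C"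
    "a < b" "b < c" "c < d"
  shows "B = C"
  using assms unfolding noncrossing_def by blast

definition is_pred :: "nat set set \<Rightarrow> nat \<Rightarrow> nat \<Rightarrow> bool" where
  "is_pred P p i \<longleftrightarrow> (\<exists>B\<in>P. p \<in> B \<and> i \<in> B \<and> p < i \<and> (\<forall>b\<in>B. b < i \<longrightarrow> b \<le> p))"

lemma has_prev_imp_is_pred:
  assumes "has_prev P i"
  shows "\<exists>p. is_pred P p i"
proof -
  obtain B b where B: "B \<in> P" "i \<in> B" "b \<in> B" "b < i"
    using assms unfolding has_prev_def by blast
  let ?S = "{b \<in> B. b < i}"
  have "finite ?S" "?S \<noteq> {}"
    using B by auto
  then have "Max ?S \<in> ?S" "\<forall>b\<in>?S. b \<le> Max ?S"
    by (rule Max_in, simp)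
  then show ?thesis
    unfolding is_pred_def using B by blast
qed

text \<open>Noncrossing confines every other block that meets the gap between the neighbours
  \<open>p\<close> and \<open>i\<close> to that gap. So the same blocks are open at \<open>p\<close>
  and just before \<open>i\<close>, while a \<open>j\<close> in the gap with a next element has its
  own block open in addition. Hence \<open>p\<close> is the last position before \<open>i\<close>
  that has a next element and whose height equals that at \<open>i - 1\<close>.\<close>

lemma open_blocks_is_pred:
  assumes "disjoint P" "noncrossing P" "is_pred P p i"
  shows "open_blocks P p = open_blocks P (i - 1)"
    and "p < j \<Longrightarrow> j < i \<Longrightarrow> has_next P j \<Longrightarrow> open_blocks P p \<subset> open_blocks P j"
proof -
  obtain B where B: "B \<in> P" "p \<in> B" "i \<in> B" "p < i" "\<forall>b\<in>B. b < i \<longrightarrow> b \<le> p"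
    using assms(3) unfolding is_pred_def by blast
  have notin: "p \<notin> C" "i \<notin> C" if "C \<in> P" "C \<noteq> B" for C
    using that B disjoint_block_eq[OF assms(1)] by blast+
  note nc = noncrossingD[OF assms(2)]
  have sub: "open_blocks P p \<subseteq> open_blocks P j" if "p \<le> j" "j < i" for j
  proof
    fix C assume "C \<in> open_blocks P p"
    then obtain c c' where C: "C \<in> P" "c \<in> C" "c \<le> p" "c' \<in> C" "p < c'"
      unfolding open_blocks_def by blast
    show "C \<in> open_blocks P j"
    proof (cases "C = B")
      case True
      then show ?thesis unfolding open_blocks_def using B that by auto
    next
      case False
      then have "c < p" "c' \<noteq> i"
        using C notin by (metis le_neq_implies_less)+
      \<comment> \<open>Otherwise \<open>c < p < c' < i\<close> would alternate between
        \<open>C\<close> and \<open>B\<close>.\<close>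
      moreover have "\<not> c' < i"
        using nc[of C B c p c' i] B C \<open>c < p\<close> False by blast
      ultimately have "j < c'" "c \<le> j" using that by auto
      then show ?thesis unfolding open_blocks_def using C by auto
    qed
  qed
  have "open_blocks P (i - 1) \<subseteq> open_blocks P p"
  proof
    fix C assume "C \<in> open_blocks P (i - 1)"
    then obtain c c' where C: "C \<in> P" "c \<in> C" "c < i" "c' \<in> C" "i \<le> c'"
      unfolding open_blocks_def using B by fastforce
    show "C \<in> open_blocks P p"
    proof (cases "C = B")
      case True
      then show ?thesis unfolding open_blocks_def using B by auto
    next
      case False
      then have "i < c'"
        using C notin by (metis le_neq_implies_less)
      then have "\<not> p < c"
        using nc[of B C p c i c'] B C False by blast
      then have "c \<le> p" "p < c'" using \<open>i < c'\<close> B by auto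
      then show ?thesis unfolding open_blocks_def using C by auto
    qed
  qed
  then show "open_blocks P p = open_blocks P (i - 1)"
    using sub[of "i - 1"] B by auto
  assume j: "p < j" "j < i" "has_next P j"
  then obtain C c' where C: "C \<in> P" "j \<in> C" "c' \<in> C" "j < c'"
    unfolding has_next_def by blast
  have "C \<noteq> B" using B j C by auto
  have "C \<notin> open_blocks P p"
  proof
    assume "C \<in> open_blocks P p"
    then obtain c where c: "c \<in> C" "c \<le> p"
      unfolding open_blocks_def by blast
    then have "c < p" using notin[OF C(1) \<open>C \<noteq> B\<close>] by (metis le_neq_implies_less)
    then show False using nc[of C B c p j i] B C c j \<open>C \<noteq> B\<close> by blast
  qed
  moreover have "C \<in> open_blocks P j"
    unfolding open_blocks_def using C by auto
  ultimately show "open_blocks P p \<subset> open_blocks P j"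
    using sub[of j] j by auto
qed

text \<open>If \<open>p < q\<close>, then \<open>q\<close> lies inside the gap of \<open>P\<close>
  and has a next element, so \<open>P\<close> is strictly higher at \<open>q\<close> than at
  \<open>p\<close>. But both heights equal the common height at \<open>i - 1\<close>. Exchanging
  \<open>P\<close> and \<open>Q\<close> later gives equality of the neighbours.\<close>

lemma is_pred_le:
  assumes "disjoint P" "finite P" "disjoint Q" "finite Q" "noncrossing P" "noncrossing Q"
    and "\<Union>P \<subseteq> {1..h}" "\<Union>Q \<subseteq> {1..h}"
    and "has_prev P = has_prev Q" "has_next P = has_next Q"
    and "is_pred P p i" "is_pred Q q i"
  shows "q \<le> p"
proof (rule ccontr)
  assume "\<not> q \<le> p"
  then have "p < q" by simp
  have "q < i" "has_next Q q"
    using assms(12) unfolding is_pred_def has_next_def by blast+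
  then have "open_blocks P p \<subset> open_blocks P q"
    using open_blocks_is_pred(2) assms \<open>p < q\<close> by simp
  then have "card (open_blocks P p) < card (open_blocks P q)"
    using finite_open_blocks[OF assms(2)] by (simp add: psubset_card_mono)
  moreover have "card (open_blocks P p) = card (open_blocks Q q)"
    using open_blocks_is_pred(1)[OF assms(1,5,11)] open_blocks_is_pred(1)[OF assms(3,6,12)]
      card_open_blocks_cong[OF assms(1-4,7-10)] by simp
  ultimately show False
    using card_open_blocks_cong[OF assms(1-4,7-10)] by simp
qed

text \<open>Strong induction on the right end: the left neighbour of \<open>i\<close> is the same in
  \<open>P\<close> and \<open>Q\<close>, and it either is \<open>a\<close> or takes the place of
  \<open>i\<close>.\<close>

lemma same_block_less:
  assumes "disjoint P" "finite P" "disjoint Q" "finite Q" "noncrossing P" "noncrossing Q"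
    and "\<Union>P \<subseteq> {1..h}" "\<Union>Q \<subseteq> {1..h}"
    and "has_prev P = has_prev Q" "has_next P = has_next Q"
  shows "a < i \<Longrightarrow> same_block P a i \<Longrightarrow> same_block Q a i"
proof (induction i rule: less_induct)
  case (less i)
  then obtain B where B: "B \<in> P" "a \<in> B" "i \<in> B"
    unfolding same_block_def by blast
  then have "has_prev P i"
    using less.prems(1) unfolding has_prev_def by blast
  moreover from this have "has_prev Q i"
    using assms(9) by simp
  ultimately obtain p q where pq: "is_pred P p i" "is_pred Q q i"
    using has_prev_imp_is_pred by blast
  have "p = q"
    using is_pred_le[OF assms pq]
      is_pred_le[OF assms(3,4,1,2,6,5,8,7) assms(9)[symmetric] assms(10)[symmetric] pq(2,1)] by simp
  then have Q: "same_block Q p i"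
    using pq unfolding is_pred_def same_block_def by blast
  obtain B' where B': "B' \<in> P" "p \<in> B'" "i \<in> B'" "p < i" "\<forall>b\<in>B'. b < i \<longrightarrow> b \<le> p"
    using pq unfolding is_pred_def by blast
  have "B' = B" using B B' disjoint_block_eq[OF assms(1)] by blast
  then have "a \<le> p" "same_block P a p"
    using B B' less.prems unfolding same_block_def by auto
  then have "a = p \<or> same_block Q a p"
    using less.IH[of p] B' by force
  then show ?case
    using Q disjoint_block_eq[OF assms(3)] unfolding same_block_def by blast
qed

lemma partition_subset_if_same_block:
  assumes "partition_on A P" "partition_on A Q"
    and eq: "\<And>a b. same_block P a b = same_block Q a b"
  shows "P \<subseteq> Q"
proof
  have block: "R \<in> {P, Q} \<Longrightarrow> D \<in> R \<Longrightarrow> m \<in> D \<Longrightarrow> D = {b. same_block R m b}" for R D m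
    using assms(1,2) disjoint_block_eq[of R] unfolding partition_on_def same_block_def by blast
  fix B assume B: "B \<in> P"
  then obtain m where m: "m \<in> B"
    using assms(1) unfolding partition_on_def by (metis ex_in_conv)
  then obtain C where C: "C \<in> Q" "m \<in> C"
    using B assms unfolding partition_on_def by blast
  have "B = C"
    using block[of P B m] block[of Q C m] B C m eq by simp
  then show "B \<in> Q" using C by simp
qed

lemma noncrossing_partition_unique:
  assumes "partition_on A P" "partition_on A Q" "A \<subseteq> {1..h}"
    and "noncrossing P" "noncrossing Q"
    and "has_prev P = has_prev Q" "has_next P = has_next Q"
  shows "P = Q"
proof -
  have fin: "finite P" "finite Q"
    using assms(1-3) finite_elements finite_subset by blast+
  have dis: "disjoint P" "disjoint Q" and sub: "\<Union>P \<subseteq> {1..h}" "\<Union>Q \<subseteq> {1..h}"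
    using assms unfolding partition_on_def by auto
  have sym: "same_block R a b = same_block R b a" for R a b
    unfolding same_block_def by blast
  \<comment> \<open>On the diagonal the relation just records membership in the common ground set
    \<open>A\<close>.\<close>
  have diag: "same_block P a a = same_block Q a a" for a
    using assms(1,2) unfolding same_block_def partition_on_def by blast
  have "same_block P a b = same_block Q a b" if "a < b" for a b
    using same_block_less[OF dis(1) fin(1) dis(2) fin(2) assms(4,5) sub assms(6,7) that]
      same_block_less[OF dis(2) fin(2) dis(1) fin(1) assms(5,4) sub(2,1)
        assms(6)[symmetric] assms(7)[symmetric] that] by blast
  then have "same_block P a b = same_block Q a b" for a b
    using sym diag by (metis linorder_less_linear)
  then show ?thesis
    using partition_subset_if_same_block[OF assms(1,2)]
      partition_subset_if_same_block[OF assms(2,1)] by blast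
qed

section \<open>Encoding states as coloured Motzkin words\<close>

datatype letter = Skip | Single | Mid bool | Open bool | Close

text \<open>The words of length \<open>n\<close> describe paths from height \<open>j\<close> to
  height 0 that never go below 0; indexing by the starting height lets the recursion strip the first
  letter.\<close>

fun words :: "nat \<Rightarrow> nat \<Rightarrow> letter list set" where
  "words 0 j = (if j = 0 then {[]} else {})"
| "words (Suc n) j =
    (\<Union>l\<in>{Skip, Single, Mid True, Mid False}. (#) l ` words n j) \<union>
    (\<Union>b. (#) (Open b) ` words n (Suc j)) \<union>
    (if j = 0 then {} else (#) Close ` words n (j - 1))"

text \<open>The Booleans record the label U. \<open>Single\<close> and \<open>Close\<close> carry no
  label: the first is forced to be \<open>LabE\<close>, the second is fixed by parity.
  \<open>Lab0\<close> is tested last because positions with a neighbour in their block lie in the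
  support.\<close>

definition letter_of :: "(nat \<Rightarrow> label) \<times> nat set set \<Rightarrow> nat \<Rightarrow> letter" where
  "letter_of s i = (case s of (x, P) \<Rightarrow>
     if has_next P i then if has_prev P i then Mid (x i = LabU) else Open (x i = LabU)
     else if has_prev P i then Close else if x i = Lab0 then Skip else Single)"

definition word_of :: "nat \<Rightarrow> (nat \<Rightarrow> label) \<times> nat set set \<Rightarrow> letter list" where
  "word_of h s = map (letter_of s) [1..<Suc h]"

lemma OmegaD:
  assumes "(x, P) \<in> Omega h"
  shows "x \<in> {1..h} \<rightarrow>\<^sub>E UNIV" "partition_on (support h x) P" "noncrossing P"
    "\<And>B. B \<in> P \<Longrightarrow> even (card {i \<in> B. x i = LabU})" "\<And>i. {i} \<in> P \<Longrightarrow> x i = LabE"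
    "disjoint P" "finite P" "\<Union>P = support h x" "\<Union>P \<subseteq> {1..h}"
proof -
  show *: "x \<in> {1..h} \<rightarrow>\<^sub>E UNIV" "partition_on (support h x) P" "noncrossing P"
    "\<And>B. B \<in> P \<Longrightarrow> even (card {i \<in> B. x i = LabU})" "\<And>i. {i} \<in> P \<Longrightarrow> x i = LabE"
    using assms unfolding Omega_def by auto
  show "disjoint P" "\<Union>P = support h x" "\<Union>P \<subseteq> {1..h}"
    using *(2) unfolding partition_on_def support_def by auto
  have "finite (support h x)" unfolding support_def by simp
  then show "finite P" using *(2) finite_elements by blast
qed

lemma Cons_in_words_iff:
  "l # w \<in> words (Suc n) j \<longleftrightarrow> (case l of
     Open b \<Rightarrow> w \<in> words n (Suc j) | Close \<Rightarrow> 0 < j \<and> w \<in> words n (j - 1) | _ \<Rightarrow> w \<in> words n j)"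
  by (cases l) (auto simp: image_iff)

lemma word_of_in_words:
  assumes "(x, P) \<in> Omega h"
  shows "word_of h (x, P) \<in> words h 0"
proof -
  note D = OmegaD[OF assms]
  \<comment> \<open>The suffix after position \<open>t\<close> is a path starting at the current
    height; the induction runs down from \<open>t = h\<close>, where no block is open.\<close>
  have "map (letter_of (x, P)) [Suc t..<Suc h] \<in> words (h - t) (card (open_blocks P t))"
    if "t \<le> h" for t
    using that
  proof (induction t rule: inc_induct)
    case base
    then show ?case using open_blocks_zero[OF D(9)] by simp
  next
    case (step t)
    then have eq: "h - t = Suc (h - Suc t)" "[Suc t..<Suc h] = Suc t # [Suc (Suc t)..<Suc h]"
      using upt_conv_Cons[of "Suc t" "Suc h"] by simp_all
    define w where "w = map (letter_of (x, P)) [Suc (Suc t)..<Suc h]"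
    have w: "w \<in> words (h - Suc t) (card (open_blocks P (Suc t)))"
      using step.IH unfolding w_def .
    have "letter_of (x, P) (Suc t) # w \<in> words (Suc (h - Suc t)) (card (open_blocks P t))"
      using w card_open_blocks_Suc[OF D(6,7), of t] unfolding Cons_in_words_iff letter_of_def
      by (cases "has_prev P (Suc t)"; cases "has_next P (Suc t)"; cases "x (Suc t) = Lab0")
        simp_all
    then show ?case
      unfolding eq w_def by simp
  qed
  from this[of 0] show ?thesis
    using open_blocks_zero[OF D(9)] by (simp add: word_of_def)
qed

text \<open>Away from \<open>i\<close> the two counts of \<open>c\<close> agree, so parity decides
  whether \<open>i\<close> contributes.\<close>

lemma card_label_parity:
  assumes "finite B" "i \<in> B" "\<And>k. k \<in> B \<Longrightarrow> k \<noteq> i \<Longrightarrow> x k = y k"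
    and "even (card {k \<in> B. x k = c})" "even (card {k \<in> B. y k = c})"
  shows "x i = c \<longleftrightarrow> y i = c"
proof -
  have split: "card {k \<in> B. z k = c} = card {k \<in> B - {i}. z k = c} + (if z i = c then 1 else 0)" for z
  proof (cases "z i = c")
    case True
    then have "{k \<in> B. z k = c} = insert i {k \<in> B - {i}. z k = c}" using assms(2) by auto
    then show ?thesis using True assms(1) by simp
  next
    case False
    then have "{k \<in> B. z k = c} = {k \<in> B - {i}. z k = c}" by auto
    then show ?thesis using False by simp
  qed
  have "{k \<in> B - {i}. x k = c} = {k \<in> B - {i}. y k = c}" using assms(3) by auto
  then show ?thesis using split[of x] split[of y] assms(4,5) by (auto split: if_splits)
qed

text \<open>The word is decoded in stages: position types, support, partition, labels of
  non-closers, and finally labels of closers, by parity from the rest of their blocks.\<close>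

lemma inj_on_word_of: "inj_on (word_of h) (Omega h)"
proof (rule inj_onI, clarify)
  fix x P y Q
  assume X: "(x, P) \<in> Omega h" and Y: "(y, Q) \<in> Omega h"
    and eq: "word_of h (x, P) = word_of h (y, Q)"
  note DX = OmegaD[OF X] and DY = OmegaD[OF Y]
  have letter: "letter_of (x, P) i = letter_of (y, Q) i" if "i \<in> {1..h}" for i
    using eq that unfolding word_of_def map_eq_conv atLeastLessThan_upt[symmetric] by simp
  \<comment> \<open>Equal words say nothing outside \<open>{1..h}\<close>; there both predicates are
    false, as all blocks lie in \<open>{1..h}\<close>.\<close>
  have outside: "\<not> has_prev R i \<and> \<not> has_next R i" if "R \<in> {P, Q}" "i \<notin> {1..h}" for R i
    using that DX(9) DY(9) unfolding has_prev_def has_next_def by blast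
  have "has_prev P i = has_prev Q i \<and> has_next P i = has_next Q i" for i
  proof (cases "i \<in> {1..h}")
    case True
    then show ?thesis using letter[of i] unfolding letter_of_def by (auto split: if_splits)
  next
    case False
    then show ?thesis using outside by blast
  qed
  then have prev_next: "has_prev P = has_prev Q" "has_next P = has_next Q" by auto
  have supp: "x i = Lab0 \<longleftrightarrow> y i = Lab0" if "i \<in> {1..h}" for i
  proof -
    have "x i \<noteq> Lab0" if "has_prev P i \<or> has_next P i"
      using that DX(8) unfolding has_prev_def has_next_def support_def by blast
    moreover have "y i \<noteq> Lab0" if "has_prev Q i \<or> has_next Q i"
      using that DY(8) unfolding has_prev_def has_next_def support_def by blast
    ultimately show ?thesis
      using letter[OF \<open>i \<in> {1..h}\<close>] prev_next unfolding letter_of_def by (auto split: if_splits)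
  qed
  then have "support h x = support h y" unfolding support_def by auto
  then have PQ: "P = Q"
    using noncrossing_partition_unique[OF DX(2) _ _ DX(3) DY(3) prev_next, of h] DY(2) DX(8,9) by simp
  have non_closer: "x i = y i" if i: "i \<in> {1..h}" "has_next P i \<or> \<not> has_prev P i" for i
  proof (cases "x i = Lab0")
    case True
    then show ?thesis using supp i by simp
  next
    case False
    then have nz: "x i \<noteq> Lab0" "y i \<noteq> Lab0" using supp i by auto
    show ?thesis
    proof (cases "has_next P i")
      case True
      then have "x i = LabU \<longleftrightarrow> y i = LabU"
        using letter[OF i(1)] PQ unfolding letter_of_def by (auto split: if_splits)
      then show ?thesis using nz by (metis label.exhaust)
    next
      case nonext: False
      \<comment> \<open>With no neighbour on either side the block is a singleton, which forces
        \<open>LabE\<close>.\<close>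
      have "i \<in> \<Union>P" using nz i DX(8) unfolding support_def by auto
      then obtain B where B: "B \<in> P" "i \<in> B" by blast
      then have "\<And>b. b \<in> B \<Longrightarrow> b = i"
        using nonext i(2) unfolding has_prev_def has_next_def by (metis linorder_less_linear)
      then have "B = {i}" using B by blast
      then show ?thesis using B PQ DX(5) DY(5) by metis
    qed
  qed
  have "x i = y i" if i: "i \<in> {1..h}" for i
  proof (cases "has_next P i \<or> \<not> has_prev P i")
    case True
    then show ?thesis using non_closer i by blast
  next
    case False
    then obtain B where B: "B \<in> P" "i \<in> B" "\<not> (\<exists>b\<in>B. i < b)"
      unfolding has_prev_def has_next_def by blast
    have sub: "B \<subseteq> {1..h}" using B DX(9) by blast
    have "x k = y k" if "k \<in> B" "k \<noteq> i" for k
    proof -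
      \<comment> \<open>A closer is the last element of its block, so every other element has a next
        one and its label is already known.\<close>
      have "k < i" using that B by (metis linorder_less_linear)
      then have "has_next P k" using B that unfolding has_next_def by blast
      then show ?thesis using non_closer[of k] sub that by auto
    qed
    then have "x i = LabU \<longleftrightarrow> y i = LabU"
      using card_label_parity[of B i x y LabU] B sub finite_subset[OF sub] DX(4) DY(4) PQ by simp
    then show ?thesis using supp[OF i] by (metis label.exhaust)
  qed
  then have "x = y"
    using DX(1) DY(1) by (intro PiE_ext) auto
  then show "x = y \<and> P = Q" using PQ by simp
qed

section \<open>Recurrence for the number of words\<close>

lemma finite_words: "finite (words n j)"
  by (induction n arbitrary: j) auto

text \<open>Union bound over the seven possible first letters; prefixing a fixed letter is
  injective.\<close>

lemma card_words_Suc: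
  "card (words (Suc n) j) \<le> 4 * card (words n j) + 2 * card (words n (Suc j))
     + (if j = 0 then 0 else card (words n (j - 1)))"
proof -
  have img: "card ((#) l ` words n k) = card (words n k)" for l :: letter and k
    by (simp add: card_image)
  have "card (\<Union>l\<in>{Skip, Single, Mid True, Mid False}. (#) l ` words n j)
      \<le> (\<Sum>l\<in>{Skip, Single, Mid True, Mid False}. card ((#) l ` words n j))"
    by (rule card_UN_le) simp
  also have "\<dots> = 4 * card (words n j)" by (simp add: img)
  finally have a: "card (\<Union>l\<in>{Skip, Single, Mid True, Mid False}. (#) l ` words n j)
      \<le> 4 * card (words n j)" .
  have "card (\<Union>b. (#) (Open b) ` words n (Suc j)) \<le> (\<Sum>b\<in>UNIV. card ((#) (Open b) ` words n (Suc j)))"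
    by (rule card_UN_le) simp
  also have "\<dots> = 2 * card (words n (Suc j))" by (simp add: img)
  finally have b: "card (\<Union>b. (#) (Open b) ` words n (Suc j)) \<le> 2 * card (words n (Suc j))" .
  have c: "card (if j = 0 then {} else (#) Close ` words n (j - 1))
      \<le> (if j = 0 then 0 else card (words n (j - 1)))"
    by (simp add: img)
  have "card (words (Suc n) j) \<le> card (\<Union>l\<in>{Skip, Single, Mid True, Mid False}. (#) l ` words n j)
      + card (\<Union>b. (#) (Open b) ` words n (Suc j))
      + card (if j = 0 then {} else (#) Close ` words n (j - 1))"
    unfolding words.simps by (meson card_Un_le add_mono order_refl order_trans)
  then show ?thesis using a b c by linarith
qed

lemma card_Omega_le: "card (Omega h) \<le> card (words h 0)"
  using inj_on_word_of word_of_in_words finite_words by (intro card_inj_on_le[of "word_of h"]) auto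

section \<open>Spectral integral for the number of paths\<close>

definition path_integral :: "nat \<Rightarrow> nat \<Rightarrow> real" where
  "path_integral n j =
     integral {0..pi} (\<lambda>t. (4 + sqrt 8 * cos t) ^ n * (sin (real (j + 1) * t) * sin t))"

lemma path_integrand_integrable:
  "(\<lambda>t::real. (4 + sqrt 8 * cos t) ^ n * (sin (c * t) * sin t)) integrable_on {0..pi}"
  by (intro integrable_continuous_interval continuous_intros)

text \<open>Orthogonality of \<open>sin ((j + 1) * t)\<close> and \<open>sin t\<close> on
  \<open>{0..pi}\<close>: the factor \<open>sin t\<close> selects the final height 0, so for the
  empty path only \<open>j = 0\<close> survives.\<close>

lemma path_integral_0: "path_integral 0 j = (if j = 0 then pi / 2 else 0)"
proof (cases "j = 0")
  case True
  have "((\<lambda>t. sin t * sin t) has_integral (pi - sin pi * cos pi) / 2 - (0 - sin 0 * cos 0) / 2) {0..pi}"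
  proof (rule fundamental_theorem_of_calculus)
    fix t :: real
    have "sin t * sin t = (1 - (cos t * cos t - sin t * sin t)) / 2"
      using sin_cos_squared_add3[of t] by (simp add: field_simps)
    then have "((\<lambda>t. (t - sin t * cos t) / 2) has_real_derivative sin t * sin t) (at t within {0..pi})"
      by (auto intro!: derivative_eq_intros)
    then show "((\<lambda>t. (t - sin t * cos t) / 2) has_vector_derivative sin t * sin t) (at t within {0..pi})"
      by (simp add: has_real_derivative_iff_has_vector_derivative)
  qed simp
  then show ?thesis
    using True by (simp add: path_integral_def integral_unique)
next
  case False
  \<comment> \<open>Product-to-sum gives the frequencies \<open>j\<close> and \<open>j + 2\<close>;
    the antiderivative divides by both, hence the separate case \<open>j = 0\<close>.\<close>
  define a where "a = real j"
  have a: "a > 0" using False a_def by simp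
  define A where "A = (\<lambda>t. (sin (a * t) / a - sin ((a + 2) * t) / (a + 2)) / 2)"
  have "((\<lambda>t. sin ((a + 1) * t) * sin t) has_integral A pi - A 0) {0..pi}"
  proof (rule fundamental_theorem_of_calculus)
    fix t :: real
    have "sin ((a + 1) * t) * sin t = (cos (a * t) - cos ((a + 2) * t)) / 2"
      unfolding sin_times_sin by (simp add: algebra_simps)
    moreover have "((\<lambda>t. sin (c * t) / c) has_real_derivative cos (c * t)) (at t within {0..pi})"
      if "c > 0" for c
      using that by (auto intro!: derivative_eq_intros)
    then have "(A has_real_derivative (cos (a * t) - cos ((a + 2) * t)) / 2) (at t within {0..pi})"
      unfolding A_def using a by (intro DERIV_cdivide DERIV_diff) auto
    ultimately have "(A has_real_derivative sin ((a + 1) * t) * sin t) (at t within {0..pi})"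
      by (simp only:)
    then show "(A has_vector_derivative sin ((a + 1) * t) * sin t) (at t within {0..pi})"
      by (simp add: has_real_derivative_iff_has_vector_derivative)
  qed simp
  moreover have "sin (a * pi) = 0" "sin ((a + 2) * pi) = 0"
    using sin_npi[of j] sin_npi[of "j + 2"] unfolding a_def by (simp_all add: add.commute)
  then have "A pi - A 0 = 0" unfolding A_def by simp
  ultimately show ?thesis
    using False unfolding path_integral_def a_def by (simp add: integral_unique add.commute)
qed

text \<open>Since \<open>sqrt 8 = 2 * sqrt 2\<close>, the identity \<open>2 * cos t * sin ((j + 1) *
  t) = sin ((j + 2) * t) + sin (j * t)\<close> turns one more factor of the integrand into one step
  with weight 4 for level and \<open>sqrt 2\<close> for both up and down.\<close>

lemma path_integral_Suc:
  "path_integral (Suc n) j = 4 * path_integral n j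
     + sqrt 2 * (path_integral n (Suc j) + (if j = 0 then 0 else path_integral n (j - 1)))"
proof -
  define f where "f = (\<lambda>c t::real. (4 + sqrt 8 * cos t) ^ n * (sin (c * t) * sin t))"
  have int: "f c integrable_on {0..pi}" for c
    unfolding f_def by (rule path_integrand_integrable)
  have sqrt8: "sqrt 8 = sqrt 2 * 2"
    using real_sqrt_mult[of 2 4] by simp
  have "path_integral (Suc n) j
      = integral {0..pi} (\<lambda>t. 4 * f (real (j + 1)) t + sqrt 2 * (f (real (j + 2)) t + f (real j) t))"
    unfolding path_integral_def
  proof (rule integral_cong)
    fix t :: real
    have "2 * cos t * sin (real (j + 1) * t) = sin (real (j + 2) * t) + sin (real j * t)"
      using sin_times_cos[of "real (j + 1) * t" t] by (simp add: algebra_simps)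
    then have *: "sqrt 8 * cos t * sin (real (j + 1) * t)
        = sqrt 2 * (sin (real (j + 2) * t) + sin (real j * t))"
      unfolding sqrt8 by (metis mult.assoc)
    have "(4 + sqrt 8 * cos t) ^ Suc n * (sin (real (j + 1) * t) * sin t)
        = (4 + sqrt 8 * cos t) ^ n * sin t
          * (4 * sin (real (j + 1) * t) + sqrt 8 * cos t * sin (real (j + 1) * t))"
      by (simp add: algebra_simps)
    also have "\<dots> = 4 * f (real (j + 1)) t + sqrt 2 * (f (real (j + 2)) t + f (real j) t)"
      unfolding * f_def by (simp add: algebra_simps)
    finally show "(4 + sqrt 8 * cos t) ^ Suc n * (sin (real (j + 1) * t) * sin t)
        = 4 * f (real (j + 1)) t + sqrt 2 * (f (real (j + 2)) t + f (real j) t)" .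
  qed
  also have "\<dots> = 4 * integral {0..pi} (f (real (j + 1)))
      + sqrt 2 * (integral {0..pi} (f (real (j + 2))) + integral {0..pi} (f (real j)))"
    by (simp add: integral_add integral_mult_right integrable_add integrable_on_mult_right int
        del: of_nat_add)
  \<comment> \<open>At \<open>j = 0\<close> the factor \<open>sin (0 * t)\<close> vanishes, which is
    exactly the barrier below height 0.\<close>
  also have "integral {0..pi} (f (real j)) = (if j = 0 then 0 else path_integral n (j - 1))"
    by (simp add: path_integral_def f_def of_nat_diff)
  finally show ?thesis
    unfolding path_integral_def f_def by simp
qed

section \<open>Upper bound for the integral\<close>

text \<open>
  With \<open>s = sin (t / 2)\<close> the integrand is at most a constant times
  \<open>(4 + sqrt 8)\<^sup>n s\<^sup>2 cos (t / 2) / (1 + n s\<^sup>2) powr (5 / 2)\<close>, and \<open>(s / sqrt (1 + n s\<^sup>2))\<^sup>3\<close> is an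
  antiderivative of this bound up to a constant factor.
\<close>
lemma path_integrand_le:
  fixes t :: real
  assumes "0 \<le> t" "t \<le> pi"
  defines "s \<equiv> sin (t / 2)"
  shows "(4 + sqrt 8 * cos t) ^ n * (sin t * sin t)
    \<le> (4 + sqrt 8) ^ n * (256 * (s\<^sup>2 * cos (t / 2) / sqrt (1 + real n * s\<^sup>2) ^ 5))"
proof -
  define c where "c = cos (t / 2)"
  define r where "r = 4 + sqrt 8"
  define y where "y = real n * s\<^sup>2"
  have c: "0 \<le> c" "c \<le> 1"
    unfolding c_def using assms by (auto intro: cos_ge_zero)
  have y: "0 \<le> y" unfolding y_def by simp
  have sin_t: "sin t = 2 * s * c" and cos_t: "cos t = 1 - 2 * s\<^sup>2"
    using sin_double[of "t / 2"] cos_double_sin[of "t / 2"] unfolding s_def c_def by simp_all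
  have sqrt8: "(27/10)\<^sup>2 \<le> (8::real)" "2 < sqrt 8" "sqrt 8 \<le> 3"
    by (simp_all add: power2_eq_square real_less_rsqrt real_le_lsqrt)
  then have sqrt8': "27 / 10 \<le> sqrt 8" by (intro real_le_rsqrt)
  have r: "r > 0" unfolding r_def using sqrt8 by linarith
  \<comment> \<open>This amounts to \<open>12 / 5 \<le> sqrt 8\<close>; with
    \<open>cos t = 1 - 2 * s\<^sup>2\<close> it bounds the base by \<open>r\<close> times
    \<open>1 - 3 / 4 * s\<^sup>2\<close>.\<close>
  have "3 / 8 * r \<le> sqrt 8" unfolding r_def using sqrt8' by simp
  then have "sqrt 8 * (2 * s\<^sup>2) \<ge> 3 / 8 * r * (2 * s\<^sup>2)"
    by (intro mult_right_mono) auto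
  then have "4 + sqrt 8 * cos t \<le> r * (1 + (- (3 / 4 * s\<^sup>2)))"
    unfolding cos_t r_def by (simp add: algebra_simps)
  also have "\<dots> \<le> r * exp (- (3 / 4 * s\<^sup>2))"
    using r by (intro mult_left_mono exp_ge_add_one_self) auto
  finally have le: "4 + sqrt 8 * cos t \<le> r * exp (- (3 / 4 * s\<^sup>2))" .
  have "sqrt 8 * - 1 \<le> sqrt 8 * cos t" by (intro mult_left_mono) auto
  then have "0 \<le> 4 + sqrt 8 * cos t" using sqrt8 by linarith
  then have "(4 + sqrt 8 * cos t) ^ n \<le> (r * exp (- (3 / 4 * s\<^sup>2))) ^ n"
    using le by (intro power_mono)
  also have "\<dots> = r ^ n * exp (- (3 / 4 * y))"
    unfolding y_def by (simp add: power_mult_distrib exp_of_nat_mult[symmetric] algebra_simps)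
  \<comment> \<open>Cubing \<open>1 + x \<le> exp x\<close> at \<open>x = y / 4\<close> gives
    polynomial decay, with \<open>64 = 4 ^ 3\<close>.\<close>
  also have "exp (- (3 / 4 * y)) \<le> 64 / (1 + y) ^ 3"
  proof -
    have "(1 + y) / 4 \<le> exp (y / 4)" using exp_ge_add_one_self[of "y / 4"] y by (simp add: field_simps)
    then have "((1 + y) / 4) ^ 3 \<le> exp (y / 4) ^ 3" using y by (intro power_mono) auto
    also have "\<dots> = exp (3 / 4 * y)" by (simp add: exp_of_nat_mult[symmetric])
    finally have "(1 + y) ^ 3 \<le> 64 * exp (3 / 4 * y)" by (simp add: power_divide)
    then show ?thesis using y by (simp add: exp_minus field_simps)
  qed
  \<comment> \<open>Weakening the exponent 3 to 5 / 2 makes the final bound a multiple of an exact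
    derivative.\<close>
  also have "64 / (1 + y) ^ 3 \<le> 64 / sqrt (1 + y) ^ 5"
  proof -
    have "sqrt (1 + y) ^ 5 \<le> sqrt (1 + y) ^ 6"
      using y by (intro power_increasing) auto
    also have "\<dots> = (1 + y) ^ 3"
      using y power_mult[of "sqrt (1 + y)" 2 3] by simp
    finally show ?thesis using y by (intro divide_left_mono) auto
  qed
  finally have pow: "(4 + sqrt 8 * cos t) ^ n \<le> r ^ n * (64 / sqrt (1 + y) ^ 5)"
    using r by simp
  have "sin t * sin t = 4 * (s\<^sup>2 * (c * c))"
    unfolding sin_t by (simp add: power2_eq_square)
  \<comment> \<open>One factor \<open>c\<close> is given up; the other stays as the inner derivative
    of \<open>s\<close>, up to the factor 2.\<close>
  also have "\<dots> \<le> 4 * (s\<^sup>2 * c)"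
    using c by (intro mult_left_mono mult_left_le) auto
  finally have "(4 + sqrt 8 * cos t) ^ n * (sin t * sin t) \<le> r ^ n * (64 / sqrt (1 + y) ^ 5) * (4 * (s\<^sup>2 * c))"
    using pow r y by (intro mult_mono[OF pow]) auto
  also have "\<dots> = r ^ n * (256 * (s\<^sup>2 * c / sqrt (1 + y) ^ 5))"
    by simp
  finally show ?thesis unfolding r_def y_def c_def .
qed

text \<open>As a function of \<open>s\<close>, the quotient
  \<open>s / sqrt (1 + m * s\<^sup>2)\<close> has derivative
  \<open>(1 + m * s\<^sup>2) powr (- 3 / 2)\<close>, so its cube produces the exponent 5 /
  2.\<close>

lemma dominating_antiderivative:
  fixes t m :: real
  assumes "m \<ge> 0"
  shows "((\<lambda>t. (sin (t / 2) / sqrt (1 + m * (sin (t / 2))\<^sup>2)) ^ 3) has_real_derivative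
    3 / 2 * ((sin (t / 2))\<^sup>2 * cos (t / 2) / sqrt (1 + m * (sin (t / 2))\<^sup>2) ^ 5)) (at t within A)"
proof -
  define s where "s = sin (t / 2)"
  define c where "c = cos (t / 2)"
  define R where "R = sqrt (1 + m * s\<^sup>2)"
  have pos: "1 + m * s\<^sup>2 > 0" using assms by (simp add: add_pos_nonneg)
  then have R: "R > 0" "R\<^sup>2 = 1 + m * s\<^sup>2" unfolding R_def by simp_all
  have dR: "((\<lambda>t. sqrt (1 + m * (sin (t / 2))\<^sup>2)) has_real_derivative m * s * c / (2 * R)) (at t within A)"
    using pos unfolding s_def c_def R_def
    by (auto intro!: derivative_eq_intros simp: field_simps)
  have ds: "((\<lambda>t. sin (t / 2)) has_real_derivative c / 2) (at t within A)"
    unfolding c_def by (auto intro!: derivative_eq_intros)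
  have "c / 2 * R - s * (m * s * c / (2 * R)) = c / 2 * (R\<^sup>2 - m * s\<^sup>2) / R"
    using R(1) by (simp add: field_simps power2_eq_square)
  then have num: "c / 2 * R - s * (m * s * c / (2 * R)) = c / (2 * R)"
    unfolding R(2) by simp
  have "((\<lambda>t. sin (t / 2) / sqrt (1 + m * (sin (t / 2))\<^sup>2)) has_real_derivative c / (2 * R) / (R * R)) (at t within A)"
    using DERIV_divide[OF ds dR] R(1) num unfolding s_def R_def by simp
  from DERIV_power[OF this, of 3]
  have "((\<lambda>t. (sin (t / 2) / sqrt (1 + m * (sin (t / 2))\<^sup>2)) ^ 3) has_real_derivative
      3 * (c / (2 * R) / (R * R) * (s / R)\<^sup>2)) (at t within A)"
    unfolding s_def R_def by simp
  also have "3 * (c / (2 * R) / (R * R) * (s / R)\<^sup>2) = 3 / 2 * (s\<^sup>2 * c / R ^ 5)"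
    using R(1) by (simp add: field_simps eval_nat_numeral)
  finally show ?thesis
    unfolding s_def c_def R_def .
qed

lemma path_integral_le:
  "path_integral n 0 \<le> 512 / 3 * ((4 + sqrt 8) ^ n / sqrt (real (n + 1) ^ 3))"
proof -
  define b where "b = (\<lambda>t. 3 / 2 * ((sin (t / 2))\<^sup>2 * cos (t / 2) / sqrt (1 + real n * (sin (t / 2))\<^sup>2) ^ 5))"
  define G where "G = (\<lambda>t. (sin (t / 2) / sqrt (1 + real n * (sin (t / 2))\<^sup>2)) ^ 3)"
  have "(b has_integral G pi - G 0) {0..pi}"
    unfolding b_def G_def
    by (intro fundamental_theorem_of_calculus)
      (auto intro!: dominating_antiderivative
        simp only: has_real_derivative_iff_has_vector_derivative[symmetric] pi_ge_zero of_nat_0_le_iff)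
  \<comment> \<open>The constant is \<open>256 * (2 / 3)\<close>: 256 from the pointwise bound, 2 /
    3 to cancel the factor in \<open>b\<close>.\<close>
  then have b: "((\<lambda>t. (4 + sqrt 8) ^ n * (512 / 3 * b t)) has_integral
      (4 + sqrt 8) ^ n * (512 / 3 * (G pi - G 0))) {0..pi}"
    by (intro has_integral_mult_right)
  have "path_integral n 0 \<le> (4 + sqrt 8) ^ n * (512 / 3 * (G pi - G 0))"
    unfolding path_integral_def
    unfolding integral_unique[OF b, symmetric]
  proof (rule integral_le)
    show "(\<lambda>t. (4 + sqrt 8 * cos t) ^ n * (sin (real (0 + 1) * t) * sin t)) integrable_on {0..pi}"
      by (rule path_integrand_integrable)
    show "(\<lambda>t. (4 + sqrt 8) ^ n * (512 / 3 * b t)) integrable_on {0..pi}"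
      using b by blast
    show "(4 + sqrt 8 * cos t) ^ n * (sin (real (0 + 1) * t) * sin t) \<le> (4 + sqrt 8) ^ n * (512 / 3 * b t)"
      if "t \<in> {0..pi}" for t
      using path_integrand_le[of t n] that unfolding b_def by (simp add: mult.commute)
  qed
  \<comment> \<open>Here \<open>sin (t / 2)\<close> runs from 0 to 1, so the end point
    \<open>pi\<close> supplies the decay of order \<open>(n + 1) powr (- 3 / 2)\<close>.\<close>
  also have "G pi - G 0 = 1 / sqrt (real (n + 1) ^ 3)"
    unfolding G_def by (simp add: power_divide real_sqrt_power add.commute)
  finally show ?thesis by (simp add: field_simps)
qed


section \<open>Comparing word counts with the integral\<close>

lemma card_words_le: "real (card (words n j)) \<le> 2 / pi * (1 / sqrt 2) ^ j * path_integral n j"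
proof (induction n arbitrary: j)
  case 0
  \<comment> \<open>The factor \<open>2 / pi\<close> normalises the value \<open>pi / 2\<close> of
    the integral at \<open>j = 0\<close>.\<close>
  then show ?case by (simp add: path_integral_0)
next
  case (Suc n)
  define b where "b = (\<lambda>j. 2 / pi * (1 / sqrt 2) ^ j * path_integral n j)"
  have IH: "real (card (words n k)) \<le> b k" for k
    unfolding b_def by (rule Suc.IH)
  \<comment> \<open>The factor \<open>(1 / sqrt 2) ^ j\<close> symmetrises the step weights: 2 for
    up and 1 for down both become \<open>sqrt 2\<close>.\<close>
  have up: "2 * b (Suc j) = 2 / pi * (1 / sqrt 2) ^ j * (sqrt 2 * path_integral n (Suc j))"
    unfolding b_def by (simp add: field_simps)
  have down: "b (j - 1) = 2 / pi * (1 / sqrt 2) ^ j * (sqrt 2 * path_integral n (j - 1))" if "j \<noteq> 0"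
    using that unfolding b_def by (cases j) (simp_all add: field_simps)
  have "real (card (words (Suc n) j)) \<le> 4 * real (card (words n j)) + 2 * real (card (words n (Suc j)))
      + (if j = 0 then 0 else real (card (words n (j - 1))))"
    using of_nat_mono[OF card_words_Suc[of n j], where 'a = real] by (simp split: if_splits)
  also have "\<dots> \<le> 4 * b j + 2 * b (Suc j) + (if j = 0 then 0 else b (j - 1))"
    using IH[of j] IH[of "Suc j"] IH[of "j - 1"] by (cases "j = 0") auto
  also have "\<dots> = 2 / pi * (1 / sqrt 2) ^ j * path_integral (Suc n) j"
    unfolding up path_integral_Suc using down
    by (cases "j = 0") (simp_all add: b_def algebra_simps)
  finally show ?case .
qed

theorem theorem1:
  shows "(\<lambda>h::nat. real (card (Omega h)))
           \<in> O[at_top](\<lambda>h. (4 + sqrt 8) ^ (h + 1) / sqrt (real (h + 1) ^ 3))"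
proof (rule bigoI, rule always_eventually, rule allI)
  fix h :: nat
  define g where "g = (4 + sqrt 8) ^ h / sqrt (real (h + 1) ^ 3)"
  have "g \<ge> 0" unfolding g_def by simp
  \<comment> \<open>The bound obtained has exponent \<open>h\<close>; a further factor
    \<open>4 + sqrt 8 \<ge> 1\<close> raises it to the stated \<open>h + 1\<close>.\<close>
  then have "g * 1 \<le> g * (4 + sqrt 8)" by (intro mult_left_mono) auto
  have "real (card (Omega h)) \<le> 2 / pi * path_integral h 0"
    using card_Omega_le[of h] card_words_le[of h 0] by simp
  also have "\<dots> \<le> 2 / pi * (512 / 3 * g)"
    unfolding g_def by (intro mult_left_mono path_integral_le) auto
  also have "\<dots> \<le> 2 / pi * (512 / 3 * (g * (4 + sqrt 8)))"
    using \<open>g * 1 \<le> g * (4 + sqrt 8)\<close> by (intro mult_left_mono) auto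
  also have "\<dots> = 2 / pi * (512 / 3) * norm ((4 + sqrt 8) ^ (h + 1) / sqrt (real (h + 1) ^ 3))"
    unfolding g_def by (simp add: field_simps)
  finally show "norm (real (card (Omega h)))
      \<le> 2 / pi * (512 / 3) * norm ((4 + sqrt 8) ^ (h + 1) / sqrt (real (h + 1) ^ 3))"
    by simp
qed

end
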